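(* Let $G$ be a finite simple graph on $n\geq 2$ vertices, let $G^c$ be its complement, and let $\lambda_2(H)$ denote the second smallest eigenvalue of the normalized Laplacian matrix $\mathcal{L}(H)$ of a graph $H$. Then \[\max\{\lambda_2(G),\lambda_2(G^c)\}>\frac{2}{n^2}\quad\text{if $n$ is even},\qquad \max\{\lambda_2(G),\lambda_2(G^c)\}>\frac{2}{(n-1)^2}\quad\text{if $n$ is odd}.\]
   Context: For a graph $H$ with adjacency matrix $A$ and diagonal degree matrix $D$, the combinatorial Laplacian is $L=D-A$ and the normalized Laplacian is $\mathcal{L}(H)=D^{-1/2}LD^{-1/2}$ (with the standard convention that $D^{-1/2}$ has diagonal entry $0$ at isolated vertices). Its eigenvalues are ordered $0=\lambda_1(H)\leq\lambda_2(H)\leq\cdots\leq\lambda_n(H)\leq 2$. The complement $G^c$ has the same vertex set as $G$ and contains exactly the pairs of distinct vertices that are not edges of $G$. *)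

theory Defs
  imports
    "HOL-Analysis.Analysis"
    "HOL-Computational_Algebra.Polynomial"
    "HOL-Library.Multiset"
begin

text \<open>A simple graph whose vertex set is the whole of the finite type \<open>'v\<close>, given by its adjacency
  relation.\<close>

definition simple_graph :: "('v \<Rightarrow> 'v \<Rightarrow> bool) \<Rightarrow> bool" where
  "simple_graph G \<longleftrightarrow> symp G \<and> irreflp G"

definition graph_complement :: "('v \<Rightarrow> 'v \<Rightarrow> bool) \<Rightarrow> 'v \<Rightarrow> 'v \<Rightarrow> bool" where
  "graph_complement G u v \<longleftrightarrow> u \<noteq> v \<and> \<not> G u v"

definition vertex_degree :: "('v::finite \<Rightarrow> 'v \<Rightarrow> bool) \<Rightarrow> 'v \<Rightarrow> nat" where
  "vertex_degree G u = card {v. G u v}"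

definition adjacency_matrix :: "('v::finite \<Rightarrow> 'v \<Rightarrow> bool) \<Rightarrow> real ^ 'v ^ 'v" where
  "adjacency_matrix G = (\<chi> u v. if G u v then 1 else 0)"

definition degree_matrix :: "('v::finite \<Rightarrow> 'v \<Rightarrow> bool) \<Rightarrow> real ^ 'v ^ 'v" where
  "degree_matrix G = (\<chi> u v. if u = v then real (vertex_degree G u) else 0)"

definition laplacian :: "('v::finite \<Rightarrow> 'v \<Rightarrow> bool) \<Rightarrow> real ^ 'v ^ 'v" where
  "laplacian G = degree_matrix G - adjacency_matrix G"

text \<open>At an isolated vertex the diagonal entry is \<open>1 / sqrt 0 = 0\<close>, which is the usual convention
  for \<open>D\<^bsup>-1/2\<^esup>\<close>.\<close>

definition inv_sqrt_degree_matrix :: "('v::finite \<Rightarrow> 'v \<Rightarrow> bool) \<Rightarrow> real ^ 'v ^ 'v" where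
  "inv_sqrt_degree_matrix G =
     (\<chi> u v. if u = v then 1 / sqrt (real (vertex_degree G u)) else 0)"

definition normalized_laplacian :: "('v::finite \<Rightarrow> 'v \<Rightarrow> bool) \<Rightarrow> real ^ 'v ^ 'v" where
  "normalized_laplacian G =
     inv_sqrt_degree_matrix G ** laplacian G ** inv_sqrt_degree_matrix G"

definition charpoly :: "'a::comm_ring_1 ^ 'n ^ 'n \<Rightarrow> 'a poly" where
  "charpoly A = det (mat [:0, 1:] - (\<chi> i j. [:A $ i $ j:]))"

text \<open>The real eigenvalues in increasing order, repeated according to multiplicity. For a symmetric
  matrix the characteristic polynomial splits over the reals, so the list then has length
  \<open>CARD('n)\<close>.\<close>

definition eigenvalue_list :: "real ^ 'n ^ 'n \<Rightarrow> real list" where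
  "eigenvalue_list A = sorted_list_of_multiset (proots (charpoly A))"

text \<open>Eigenvalues are numbered from 1 while list positions start at 0, so the second smallest
  eigenvalue is \<open>nl_eigenvalue G 2\<close>.\<close>

definition nl_eigenvalue :: "('v::finite \<Rightarrow> 'v \<Rightarrow> bool) \<Rightarrow> nat \<Rightarrow> real" where
  "nl_eigenvalue G k = eigenvalue_list (normalized_laplacian G) ! (k - 1)"

lemma poly_charpoly: "poly (charpoly A) x = det (mat x - A)"
proof -
  have "poly (charpoly A) x =
      (\<Sum>p | p permutes UNIV. of_int (sign p) *
        (\<Prod>i\<in>UNIV. poly ((mat [:0, 1:] - (\<chi> i j. [:A $ i $ j:])) $ i $ p i) x))"
    by (simp add: charpoly_def det_def poly_sum poly_prod of_int_poly)
  also have "\<dots> = det (mat x - A)"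
    unfolding det_def by (intro sum.cong prod.cong arg_cong2[where f = "(*)"]) (auto simp: mat_def)
  finally show ?thesis .
qed

lemma poly_charpoly_eq_0_iff:
  fixes A :: "real ^ 'n ^ 'n"
  shows "poly (charpoly A) x = 0 \<longleftrightarrow> (\<exists>v. v \<noteq> 0 \<and> A *v v = x *\<^sub>R v)"
proof -
  have "poly (charpoly A) x = 0 \<longleftrightarrow> \<not> invertible (mat x - A)"
    by (simp add: poly_charpoly invertible_det_nz)
  also have "\<dots> \<longleftrightarrow> (\<exists>v. v \<noteq> 0 \<and> (mat x - A) *v v = 0)"
    by (auto simp: invertible_left_inverse matrix_left_invertible_ker)
  also have "\<dots> \<longleftrightarrow> (\<exists>v. v \<noteq> 0 \<and> A *v v = x *\<^sub>R v)"
  proof -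
    have "(mat x :: real ^ 'n ^ 'n) *v v = x *\<^sub>R v" for v
      by (simp add: vec_eq_iff matrix_vector_mult_def mat_def if_distrib if_distribR cong: if_cong)
    then show ?thesis by (auto simp: matrix_vector_mult_diff_rdistrib)
  qed
  finally show ?thesis .
qed

end

theory Submission
  imports Defs
begin

text \<open>
  If \<open>\<lambda>\<^sub>2(G)\<close> is at most \<open>2 / m\<^sup>2\<close>, the Rayleigh quotient yields a function \<open>f\<close> which, after an affine
  rescaling, has maximum \<open>f p = 1\<close> and minimum \<open>f q = -1\<close> and whose Dirichlet energy is at most
  \<open>2 / m\<^sup>2\<close> times \<open>\<Sum> d(u) f(u)\<^sup>2\<close>, hence at most \<open>2 / m\<^sup>2\<close> times the volume of \<open>G\<close>. Small energy
  means large effective resistance between \<open>p\<close> and \<open>q\<close>: they are neither adjacent nor have a common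
  neighbour. If \<open>\<lambda>\<^sub>2\<close> of the complement is small too, the same holds there for a pair \<open>s, t\<close>. Then
  \<open>p, s, t, q\<close> induces a path (up to swapping \<open>s\<close> and \<open>t\<close>), and the energy of a further vertex
  rules out everything but all remaining vertices being joined to exactly \<open>s\<close> and \<open>t\<close> among the
  four. In that graph \<open>p\<close> and \<open>q\<close> have degree 1, and the volume is too small for the energy.
\<close>

section \<open>Eigenvalues of symmetric matrices\<close>

lemma symmetric_matrix_inner:
  fixes A :: "real ^ 'n ^ 'n"
  assumes "transpose A = A"
  shows "x \<bullet> (A *v y) = (A *v x) \<bullet> y"
  by (metis assms dot_lmul_matrix transpose_matrix_vector)

text \<open>For small \<open>t\<close> with the sign of \<open>a\<close> the linear term dominates.
  This is the first-order condition at a maximum, in a form that avoids derivatives.\<close>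

lemma linear_term_zero_of_quadratic_nonpos:
  fixes a b :: real
  assumes "\<And>t. 2 * t * a + t\<^sup>2 * b \<le> 0"
  shows "a = 0"
proof (rule ccontr)
  assume "a \<noteq> 0"
  define t where "t = a / (\<bar>b\<bar> + 1)"
  have pos: "\<bar>b\<bar> + 1 > 0" by simp
  have a: "a = t * (\<bar>b\<bar> + 1)" using pos by (simp add: t_def)
  have "t \<noteq> 0" using \<open>a \<noteq> 0\<close> a by auto
  have "2 * t * a + t\<^sup>2 * b = t\<^sup>2 * (2 * \<bar>b\<bar> + 2 + b)"
    unfolding a by (simp add: algebra_simps power2_eq_square)
  moreover have "t\<^sup>2 * (2 * \<bar>b\<bar> + 2 + b) > 0"
    using \<open>t \<noteq> 0\<close> by (intro mult_pos_pos) auto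
  ultimately show False using assms[of t] by linarith
qed

text \<open>The quadratic form of \<open>A\<close> attains its maximum on the unit sphere of
  \<open>S\<close>. At a maximiser the residual \<open>A *v x - l *\<^sub>R x\<close> lies in
  \<open>S\<close> by invariance, and optimality in its own direction forces it to vanish.\<close>

lemma symmetric_eigenvector_in_subspace:
  fixes A :: "real ^ 'n ^ 'n"
  assumes sym: "transpose A = A" and sub: "subspace S" and inv: "\<And>x. x \<in> S \<Longrightarrow> A *v x \<in> S"
    and nz: "z \<in> S" "z \<noteq> 0"
  obtains x l where "x \<in> S" "norm x = 1" "A *v x = l *\<^sub>R x"
proof -
  have "compact (sphere 0 1 \<inter> S)"
    using sub by (intro compact_Int_closed closed_subspace) auto
  moreover have "z /\<^sub>R norm z \<in> sphere 0 1 \<inter> S"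
    using nz sub by (auto intro: subspace_mul)
  moreover have "continuous_on (sphere 0 1 \<inter> S) (\<lambda>x. x \<bullet> (A *v x))"
    by (intro continuous_intros linear_continuous_on linear_linear[THEN iffD1] matrix_vector_mul_linear)
  ultimately obtain x where x: "x \<in> sphere 0 1 \<inter> S"
      and mx: "\<And>y. y \<in> sphere 0 1 \<inter> S \<Longrightarrow> y \<bullet> (A *v y) \<le> x \<bullet> (A *v x)"
    using continuous_attains_sup[of "sphere 0 1 \<inter> S" "\<lambda>x. x \<bullet> (A *v x)"] by blast
  have nx: "norm x = 1" "x \<in> S" using x by auto
  define l where "l = x \<bullet> (A *v x)"
  have le: "y \<bullet> (A *v y) \<le> l * (y \<bullet> y)" if "y \<in> S" for y
  proof (cases "y = 0")
    case False
    have "y /\<^sub>R norm y \<in> sphere 0 1 \<inter> S"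
      using False that sub by (auto intro: subspace_mul)
    from mx[OF this] have "(y \<bullet> (A *v y)) / (norm y)\<^sup>2 \<le> l"
      by (simp add: l_def matrix_vector_mult_scaleR power2_eq_square field_simps)
    then show ?thesis using False by (simp add: field_simps power2_norm_eq_inner)
  qed simp
  define h where "h = A *v x - l *\<^sub>R x"
  have hS: "h \<in> S" unfolding h_def using inv nx sub by (intro subspace_diff subspace_mul) auto
  \<comment> \<open>This is \<open>le\<close> at \<open>x + t *\<^sub>R h\<close>. By symmetry of
    \<open>A\<close> the coefficient of \<open>t\<close> is twice
    \<open>h \<bullet> (A *v x) - l * (h \<bullet> x)\<close>, which is
    \<open>h \<bullet> h\<close>.\<close>
  have "2 * t * (h \<bullet> h) + t\<^sup>2 * (h \<bullet> (A *v h) - l * (h \<bullet> h)) \<le> 0" for t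
  proof -
    have "x + t *\<^sub>R h \<in> S" using hS nx sub by (intro subspace_add subspace_mul) auto
    from le[OF this] have "x \<bullet> (A *v x) + t * (x \<bullet> (A *v h)) + t * (h \<bullet> (A *v x)) + t * (t * (h \<bullet> (A *v h)))
        \<le> l * (x \<bullet> x + t * (x \<bullet> h) + t * (h \<bullet> x) + t * (t * (h \<bullet> h)))"
      by (simp add: matrix_vector_right_distrib matrix_vector_mult_scaleR inner_add_left
          inner_add_right add.assoc distrib_left)
    moreover have "x \<bullet> (A *v h) = h \<bullet> (A *v x)"
      using symmetric_matrix_inner[OF sym, of x h] by (simp add: inner_commute)
    moreover have "h \<bullet> (A *v x) = h \<bullet> h + l * (h \<bullet> x)"
      using inner_diff_right[of h "A *v x" "l *\<^sub>R x"] by (simp flip: h_def)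
    moreover have "x \<bullet> x = 1" using nx by (simp add: norm_eq_1)
    ultimately show ?thesis
      by (simp add: l_def[symmetric] inner_commute[of x h] algebra_simps power2_eq_square)
  qed
  then have "h \<bullet> h = 0" by (rule linear_term_zero_of_quadratic_nonpos)
  then have "A *v x = l *\<^sub>R x" by (simp add: h_def)
  then show ?thesis using that nx by blast
qed

text \<open>Induction: the orthogonal complement of the eigenvectors found so far is invariant under
  \<open>A\<close> and nonzero as long as \<open>k\<close> is below the dimension, so it contains a
  further one.\<close>

lemma symmetric_orthonormal_eigenvectors:
  fixes A :: "real ^ 'n ^ 'n"
  assumes sym: "transpose A = A" and "k \<le> CARD('n)"
  shows "\<exists>B. finite B \<and> card B = k \<and> pairwise orthogonal B \<and>
    (\<forall>b\<in>B. norm b = 1 \<and> (\<exists>l. A *v b = l *\<^sub>R b))"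
  using assms(2)
proof (induction k)
  case 0
  show ?case by (intro exI[of _ "{}"]) auto
next
  case (Suc k)
  then obtain B where B: "finite B" "card B = k" "pairwise orthogonal B"
      "\<And>b. b \<in> B \<Longrightarrow> norm b = 1" "\<And>b. b \<in> B \<Longrightarrow> \<exists>l. A *v b = l *\<^sub>R b"
    by auto
  define S where "S = {x. \<forall>b\<in>B. b \<bullet> x = 0}"
  have "subspace S" by (auto simp: S_def subspace_def inner_add_right)
  moreover have "A *v x \<in> S" if "x \<in> S" for x
    unfolding S_def
  proof safe
    fix b assume "b \<in> B"
    with B(5) obtain l where "A *v b = l *\<^sub>R b" by blast
    then show "b \<bullet> (A *v x) = 0"
      using that \<open>b \<in> B\<close> by (simp add: symmetric_matrix_inner[OF sym] S_def)
  qed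
  moreover obtain z where "z \<noteq> 0" "z \<in> S"
  proof -
    have "dim (span B) < DIM(real ^ 'n)"
      using dim_le_card'[OF B(1)] B(2) Suc.prems by simp
    then obtain z where z: "z \<noteq> 0" "\<And>y. y \<in> span (span B) \<Longrightarrow> orthogonal z y"
      using orthogonal_to_subspace_exists[of "span B"] by metis
    then have "b \<bullet> z = 0" if "b \<in> B" for b
      using that by (metis inner_commute orthogonal_def span_base)
    then show ?thesis using that z(1) by (simp add: S_def)
  qed
  ultimately obtain x l where x: "x \<in> S" "norm x = 1" "A *v x = l *\<^sub>R x"
    using symmetric_eigenvector_in_subspace[OF sym] by metis
  have "x \<notin> B" using x by (auto simp: S_def norm_eq_1)
  moreover have "pairwise orthogonal (insert x B)"
    using B(3) x(1) by (auto simp: pairwise_insert S_def orthogonal_def[of x] orthogonal_def[of _ x]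
        inner_commute)
  ultimately show ?case
    using B x by (intro exI[of _ "insert x B"]) auto
qed

lemma symmetric_eigenbasis:
  fixes A :: "real ^ 'n ^ 'n"
  assumes sym: "transpose A = A"
  obtains e :: "'n \<Rightarrow> real ^ 'n" and l :: "'n \<Rightarrow> real"
  where "\<And>i j. e i \<bullet> e j = (if i = j then 1 else 0)" "\<And>i. A *v e i = l i *\<^sub>R e i"
proof -
  obtain B where B: "finite B" "card B = CARD('n)" "pairwise orthogonal B"
      "\<And>b. b \<in> B \<Longrightarrow> norm b = 1" "\<And>b. b \<in> B \<Longrightarrow> \<exists>l. A *v b = l *\<^sub>R b"
    using symmetric_orthonormal_eigenvectors[OF sym, of "CARD('n)"] by auto
  obtain e where e: "bij_betw e (UNIV :: 'n set) B"
    using B finite_same_card_bij[of "UNIV :: 'n set" B] by auto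
  have eB: "e i \<in> B" for i using e by (auto simp: bij_betw_def)
  have "e i \<bullet> e j = (if i = j then 1 else 0)" for i j
  proof (cases "i = j")
    case False
    then have "e i \<noteq> e j" using e by (auto simp: bij_betw_def inj_on_def)
    then show ?thesis using B(3) eB False by (auto simp: pairwise_def orthogonal_def)
  qed (use B(4) eB in \<open>auto simp: norm_eq_1\<close>)
  moreover have "\<forall>i. \<exists>l. A *v e i = l *\<^sub>R e i" using B(5) eB by blast
  then obtain l where "\<And>i. A *v e i = l i *\<^sub>R e i" by metis
  ultimately show ?thesis using that by blast
qed

text \<open>With the eigenvectors as columns of \<open>P\<close>,
  \<open>(mat x - A) ** P = P ** D\<close> for a diagonal \<open>D\<close>; cancelling
  \<open>det P\<close> leaves the product.\<close>

lemma charpoly_eq_prod_eigenvalues: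
  fixes A :: "real ^ 'n ^ 'n" and e :: "'n \<Rightarrow> real ^ 'n"
  assumes on: "\<And>i j. e i \<bullet> e j = (if i = j then 1 else 0)" and ev: "\<And>i. A *v e i = l i *\<^sub>R e i"
  shows "charpoly A = (\<Prod>i\<in>UNIV. [:- l i, 1:])"
proof -
  define P :: "real ^ 'n ^ 'n" where "P = (\<chi> i j. e j $ i)"
  have "transpose P ** P = mat 1"
    using on by (simp add: P_def vec_eq_iff matrix_matrix_mult_def transpose_def mat_def inner_vec_def)
  then have "det P \<noteq> 0"
    by (metis det_I det_mul mult_zero_right zero_neq_one)
  have "poly (charpoly A) x = poly (\<Prod>i\<in>UNIV. [:- l i, 1:]) x" for x
  proof -
    define D :: "real ^ 'n ^ 'n" where "D = (\<chi> i j. if i = j then x - l i else 0)"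
    have ev': "(\<Sum>k\<in>UNIV. A $ i $ k * e j $ k) = l j * e j $ i" for i j
      using arg_cong[OF ev[of j], of "\<lambda>v. v $ i"] by (simp add: matrix_vector_mult_def)
    have "(mat x - A) ** P = P ** D"
    proof (intro vec_eq_iff[THEN iffD2] allI)
      fix i j
      have "((mat x - A) ** P) $ i $ j =
          (\<Sum>k\<in>UNIV. (if k = i then x * e j $ k else 0) - A $ i $ k * e j $ k)"
        by (auto simp: matrix_matrix_mult_def P_def mat_def left_diff_distrib intro!: sum.cong)
      also have "\<dots> = e j $ i * (x - l j)"
        unfolding sum_subtractf ev' by (simp add: algebra_simps)
      also have "\<dots> = (P ** D) $ i $ j"
        by (simp add: matrix_matrix_mult_def P_def D_def if_distrib cong: if_cong)
      finally show "((mat x - A) ** P) $ i $ j = (P ** D) $ i $ j" .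
    qed
    then have "det (mat x - A) * det P = det P * det D" by (metis det_mul)
    then have "det (mat x - A) = det D" using \<open>det P \<noteq> 0\<close> by simp
    also have "\<dots> = (\<Prod>i\<in>UNIV. x - l i)" by (subst det_diagonal) (auto simp: D_def)
    finally show ?thesis by (simp add: poly_charpoly poly_prod)
  qed
  then show ?thesis by (simp add: poly_eq_poly_eq_iff[symmetric] fun_eq_iff)
qed

lemma proots_prod_linear:
  fixes l :: "'n \<Rightarrow> 'a :: idom"
  assumes "finite I"
  shows "proots (\<Prod>i\<in>I. [:- l i, 1:]) = image_mset l (mset_set I)"
  using assms
proof (induction I rule: finite_induct)
  case (insert i I)
  then have "(\<Prod>i\<in>I. [:- l i, 1:]) \<noteq> 0" by auto
  then have "proots ([:- l i, 1:] * (\<Prod>i\<in>I. [:- l i, 1:])) =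
      proots [:- l i, 1:] + proots (\<Prod>i\<in>I. [:- l i, 1:])"
    by (intro proots_mult) auto
  then show ?case using insert by simp
qed simp

lemma sorted_list_of_image_mset_first_two:
  fixes l :: "'n::finite \<Rightarrow> real"
  assumes "CARD('n) \<ge> 2"
  obtains i j where "i \<noteq> j" "l i \<le> l j"
    "sorted_list_of_multiset (image_mset l (mset_set UNIV)) ! 1 = l j"
proof -
  define xs where "xs = sorted_list_of_multiset (image_mset l (mset_set (UNIV :: 'n set)))"
  have mx: "mset xs = image_mset l (mset_set UNIV)" by (simp add: xs_def)
  have "length xs = CARD('n)" by (metis mx size_mset size_image_mset size_mset_set)
  then obtain a b ys where xs: "xs = a # b # ys"
    using assms by (cases xs; cases "tl xs") auto
  have "sorted xs" by (simp add: xs_def)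
  then have "a \<le> b" by (simp add: xs)
  have "a \<in># image_mset l (mset_set UNIV)" unfolding mx[symmetric] xs by simp
  then obtain i where i: "l i = a" by auto
  \<comment> \<open>Removing the index rather than the value gives \<open>j \<noteq> i\<close> even
    for a repeated eigenvalue.\<close>
  have "mset_set (UNIV :: 'n set) = add_mset i (mset_set (UNIV - {i}))"
    by (simp add: mset_set.remove)
  then have "mset (b # ys) = image_mset l (mset_set (UNIV - {i}))"
    using mx by (simp add: xs i)
  then have "b \<in># image_mset l (mset_set (UNIV - {i}))" by (metis list.set_intros(1) set_mset_mset)
  then obtain j where "j \<noteq> i" "l j = b" by auto
  then show ?thesis using that[of i j] i \<open>a \<le> b\<close> by (simp add: xs_def[symmetric] xs)
qed

text \<open>One half of the Courant-Fischer principle: the span of eigenvectors for the two smallest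
  eigenvalues is two-dimensional, so it meets the hyperplane orthogonal to any \<open>z\<close>, and
  on it the Rayleigh quotient is at most the larger eigenvalue.\<close>

lemma second_eigenvalue_test_vector:
  fixes A :: "real ^ 'n ^ 'n"
  assumes sym: "transpose A = A" and "CARD('n) \<ge> 2"
  obtains y where "y \<noteq> 0" "y \<bullet> z = 0" "y \<bullet> (A *v y) \<le> (eigenvalue_list A ! 1) * (y \<bullet> y)"
proof -
  obtain e :: "'n \<Rightarrow> real ^ 'n" and l
    where on: "\<And>i j. e i \<bullet> e j = (if i = j then 1 else 0)" and ev: "\<And>i. A *v e i = l i *\<^sub>R e i"
    by (rule symmetric_eigenbasis[OF sym]) blast
  obtain i j where ij: "i \<noteq> j" "l i \<le> l j" "eigenvalue_list A ! 1 = l j"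
    using sorted_list_of_image_mset_first_two[OF assms(2), of l]
    by (auto simp: eigenvalue_list_def charpoly_eq_prod_eigenvalues[OF on ev] proots_prod_linear)
  obtain a b where ab: "a \<noteq> 0 \<or> b \<noteq> 0" "a * (e i \<bullet> z) + b * (e j \<bullet> z) = 0"
  proof (cases "e j \<bullet> z = 0")
    case True then show ?thesis using that[of 0 1] by simp
  next
    case False then show ?thesis using that[of "e j \<bullet> z" "- (e i \<bullet> z)"] by (simp add: algebra_simps)
  qed
  define y where "y = a *\<^sub>R e i + b *\<^sub>R e j"
  have yy: "y \<bullet> y = a\<^sup>2 + b\<^sup>2"
    using ij(1) by (simp add: y_def inner_add_left inner_add_right on power2_eq_square)
  have "y \<bullet> (A *v y) = l i * a\<^sup>2 + l j * b\<^sup>2"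
    using ij(1) by (simp add: y_def inner_add_left inner_add_right on power2_eq_square
        matrix_vector_right_distrib matrix_vector_mult_scaleR ev)
  also have "\<dots> \<le> l j * a\<^sup>2 + l j * b\<^sup>2" using ij(2) by (simp add: mult_right_mono)
  finally have "y \<bullet> (A *v y) \<le> (eigenvalue_list A ! 1) * (y \<bullet> y)"
    unfolding yy ij(3) by (simp add: algebra_simps)
  moreover have "y \<bullet> z = 0" using ab by (simp add: y_def inner_add_left)
  moreover have "y \<noteq> 0" using yy ab(1) by (auto simp: sum_power2_eq_zero_iff)
  ultimately show ?thesis using that by blast
qed

section \<open>Test functions for the normalized Laplacian\<close>

text \<open>The sum runs over ordered pairs and meets every edge twice, hence the division by
  2.\<close>

definition dirichlet_energy :: "('v::finite \<Rightarrow> 'v \<Rightarrow> bool) \<Rightarrow> ('v \<Rightarrow> real) \<Rightarrow> real" where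
  "dirichlet_energy G f = (\<Sum>(u, v) | G u v. (f u - f v)\<^sup>2) / 2"

lemma dirichlet_energy_nonneg: "dirichlet_energy G f \<ge> 0"
  unfolding dirichlet_energy_def by (auto intro!: sum_nonneg divide_nonneg_nonneg)

lemma dirichlet_energy_affine:
  "dirichlet_energy G (\<lambda>u. a * (f u - c)) = a\<^sup>2 * dirichlet_energy G f"
  by (simp add: dirichlet_energy_def sum_distrib_left case_prod_unfold
      flip: right_diff_distrib power_mult_distrib)

text \<open>\<open>F\<close> picks some edges, each in one orientation; together with
  \<open>F\<inverse>\<close> it is part of the ordered-pair sum. Later lower bounds on the energy
  come from choosing small subgraphs here.\<close>

lemma dirichlet_energy_ge_sum_edges:
  assumes "symp G" "F \<subseteq> {(u, v). G u v}" "\<And>u v. (u, v) \<in> F \<Longrightarrow> (v, u) \<notin> F"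
  shows "(\<Sum>(u, v)\<in>F. (f u - f v)\<^sup>2) \<le> dirichlet_energy G f"
proof -
  have "(\<Sum>(u, v)\<in>F\<inverse>. (f u - f v)\<^sup>2) = (\<Sum>(u, v)\<in>F. (f u - f v)\<^sup>2)"
    by (rule sum.reindex_bij_witness[of _ "\<lambda>(u, v). (v, u)" "\<lambda>(u, v). (v, u)"])
      (auto simp: power2_commute)
  then have "2 * (\<Sum>(u, v)\<in>F. (f u - f v)\<^sup>2) = (\<Sum>(u, v)\<in>F \<union> F\<inverse>. (f u - f v)\<^sup>2)"
    using assms(3) by (subst sum.union_disjoint) auto
  also have "\<dots> \<le> (\<Sum>(u, v) | G u v. (f u - f v)\<^sup>2)"
    using assms(1,2) by (intro sum_mono2) (auto dest: sympD)
  finally show ?thesis by (simp add: dirichlet_energy_def)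
qed

lemma sum_edges_fst:
  "(\<Sum>(u, v) | G u v. h u) = (\<Sum>u\<in>UNIV. real (vertex_degree G u) * h u)"
proof -
  have "{(u, v). G u v} = Sigma UNIV (\<lambda>u. {v. G u v})" by auto
  then have "(\<Sum>(u, v) | G u v. h u) = (\<Sum>u\<in>UNIV. \<Sum>v | G u v. h u)"
    by (simp add: sum.Sigma[symmetric])
  then show ?thesis by (simp add: vertex_degree_def)
qed

lemma laplacian_quadratic_form:
  assumes "symp G"
  shows "x \<bullet> (laplacian G *v x) = dirichlet_energy G (\<lambda>u. x $ u)"
proof -
  let ?E = "{(u, v). G u v}"
  have "{(u, v). G u v} = Sigma UNIV (\<lambda>u. {v. G u v})" by auto
  then have E: "(\<Sum>(u, v)\<in>?E. x $ u * x $ v) = (\<Sum>u\<in>UNIV. \<Sum>v\<in>UNIV. if G u v then x $ u * x $ v else 0)"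
    by (simp add: sum.Sigma[symmetric] sum.If_cases)
  have D: "(laplacian G *v x) $ u = real (vertex_degree G u) * x $ u - (\<Sum>v\<in>UNIV. if G u v then x $ v else 0)"
    for u
  proof -
    have "(laplacian G *v x) $ u =
       (\<Sum>v\<in>UNIV. (if v = u then real (vertex_degree G u) * x $ v else 0) - (if G u v then x $ v else 0))"
      by (auto simp: laplacian_def matrix_vector_mult_def degree_matrix_def adjacency_matrix_def
          left_diff_distrib intro!: sum.cong)
    then show ?thesis by (simp add: sum_subtractf)
  qed
  have "x \<bullet> (laplacian G *v x) =
      (\<Sum>u\<in>UNIV. real (vertex_degree G u) * (x $ u)\<^sup>2) - (\<Sum>(u, v)\<in>?E. x $ u * x $ v)"
    unfolding E inner_vec_def D
    by (simp add: right_diff_distrib sum_subtractf sum_distrib_left power2_eq_square mult_ac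
        if_distrib cong: if_cong)
  moreover have "(\<Sum>(u, v)\<in>?E. (x $ v)\<^sup>2) = (\<Sum>(u, v)\<in>?E. (x $ u)\<^sup>2)"
    using assms by (intro sum.reindex_bij_witness[of _ "\<lambda>(u, v). (v, u)" "\<lambda>(u, v). (v, u)"])
      (auto dest: sympD)
  then have "(\<Sum>(u, v)\<in>?E. (x $ u - x $ v)\<^sup>2) =
      2 * (\<Sum>(u, v)\<in>?E. (x $ u)\<^sup>2) - 2 * (\<Sum>(u, v)\<in>?E. x $ u * x $ v)"
    by (simp add: power2_diff case_prod_unfold sum.distrib sum_subtractf sum_distrib_left mult.assoc)
  ultimately show ?thesis
    using sum_edges_fst[of "\<lambda>u. (x $ u)\<^sup>2" G] by (simp add: dirichlet_energy_def)
qed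

lemma inv_sqrt_degree_matrix_mult_nth:
  "(inv_sqrt_degree_matrix G *v y) $ u = y $ u / sqrt (real (vertex_degree G u))"
  by (simp add: inv_sqrt_degree_matrix_def matrix_vector_mult_def if_distribR if_distrib cong: if_cong)

lemma transpose_inv_sqrt_degree_matrix:
  "transpose (inv_sqrt_degree_matrix G) = inv_sqrt_degree_matrix G"
  by (simp add: inv_sqrt_degree_matrix_def transpose_def vec_eq_iff)

lemma transpose_normalized_laplacian:
  assumes "symp G"
  shows "transpose (normalized_laplacian G) = normalized_laplacian G"
proof -
  have "transpose (laplacian G) = laplacian G"
    using assms by (auto simp: laplacian_def transpose_def vec_eq_iff degree_matrix_def
        adjacency_matrix_def dest: sympD)
  then show ?thesis
    by (simp add: normalized_laplacian_def matrix_transpose_mul transpose_inv_sqrt_degree_matrix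
        matrix_mul_assoc)
qed

lemma normalized_laplacian_quadratic_form:
  assumes "symp G"
  shows "y \<bullet> (normalized_laplacian G *v y) =
    dirichlet_energy G (\<lambda>u. y $ u / sqrt (real (vertex_degree G u)))"
proof -
  let ?S = "inv_sqrt_degree_matrix G"
  have "y \<bullet> (normalized_laplacian G *v y) = (?S *v y) \<bullet> (laplacian G *v (?S *v y))"
    unfolding normalized_laplacian_def
    by (simp add: symmetric_matrix_inner[OF transpose_inv_sqrt_degree_matrix]
        flip: matrix_vector_mul_assoc)
  then show ?thesis
    by (simp add: laplacian_quadratic_form[OF assms] inv_sqrt_degree_matrix_mult_nth)
qed

text \<open>The bound is stated for every shift \<open>c\<close> because the degree-weighted sum of
  squares is smallest at the weighted mean, which orthogonality places at 0. This freedom later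
  allows centring \<open>f\<close> between its extremes.\<close>

lemma nl_eigenvalue_2_test_function:
  fixes G :: "'v::finite \<Rightarrow> 'v \<Rightarrow> bool"
  assumes "simple_graph G" "CARD('v) \<ge> 2"
  obtains f where "\<And>c. \<exists>u. f u \<noteq> c"
    "\<And>c. dirichlet_energy G f \<le>
      nl_eigenvalue G 2 * (\<Sum>u\<in>UNIV. real (vertex_degree G u) * (f u - c)\<^sup>2)"
proof -
  let ?d = "\<lambda>u. real (vertex_degree G u)"
  have G: "symp G" "irreflp G" using assms by (auto simp: simple_graph_def)
  \<comment> \<open>The vector of square roots of degrees corresponds to the constant functions
    under \<open>y $ u = sqrt (?d u) * g u\<close>.\<close>
  obtain y :: "real ^ 'v" where y: "y \<noteq> 0" "y \<bullet> (\<chi> u. sqrt (?d u)) = 0"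
      "y \<bullet> (normalized_laplacian G *v y) \<le> nl_eigenvalue G 2 * (y \<bullet> y)"
    using second_eigenvalue_test_vector[OF transpose_normalized_laplacian[OF G(1)] assms(2)]
    by (auto simp: nl_eigenvalue_def)
  define g where "g u = y $ u / sqrt (?d u)" for u
  have E: "dirichlet_energy G g \<le> nl_eigenvalue G 2 * (y \<bullet> y)"
    using y(3) by (simp add: normalized_laplacian_quadratic_form[OF G(1)] g_def[abs_def])
  have "nl_eigenvalue G 2 * (y \<bullet> y) \<ge> 0"
    using E dirichlet_energy_nonneg[of G g] by linarith
  moreover have "y \<bullet> y > 0" using y(1) by simp
  ultimately have nonneg: "nl_eigenvalue G 2 \<ge> 0" by (simp add: zero_le_mult_iff)
  show ?thesis
  proof (cases "\<exists>v. vertex_degree G v = 0")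
    case True
    then obtain v where "{w. G v w} = {}" by (auto simp: vertex_degree_def)
    then have "\<not> G v w \<and> \<not> G w v" for w using G(1) by (auto dest: sympD)
    \<comment> \<open>At an isolated vertex \<open>y\<close> cannot be recovered from
      \<open>g\<close>; the indicator of that vertex has energy 0 and serves instead.\<close>
    then have "dirichlet_energy G (\<lambda>u. of_bool (u = v)) = 0"
      unfolding dirichlet_energy_def by (auto intro!: sum.neutral)
    moreover obtain w where "w \<noteq> v"
      using assms(2) by (metis card_2_iff' card_le_Suc0_iff_eq finite_class.finite_UNIV
          iso_tuple_UNIV_I not_less_eq_eq numeral_2_eq_2)
    then have "\<exists>u. of_bool (u = v) \<noteq> c" for c :: real
      by (cases "c = 0") (auto intro: exI[of _ v] exI[of _ w])
    ultimately show ?thesis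
      using nonneg by (intro that[of "\<lambda>u. of_bool (u = v)"]) (auto intro!: mult_nonneg_nonneg sum_nonneg)
  next
    case False
    then have pos: "?d u > 0" for u by simp
    have yu: "y $ u = sqrt (?d u) * g u" for u
      using pos[of u] by (simp add: g_def)
    have yy: "y \<bullet> y = (\<Sum>u\<in>UNIV. ?d u * (g u)\<^sup>2)"
      using pos by (simp add: inner_vec_def yu power2_eq_square algebra_simps)
    have orth: "(\<Sum>u\<in>UNIV. ?d u * g u) = 0"
      using y(2) pos by (simp add: inner_vec_def yu algebra_simps)
    have "dirichlet_energy G g \<le> nl_eigenvalue G 2 * (\<Sum>u\<in>UNIV. ?d u * (g u - c)\<^sup>2)" for c
    proof -
      have "(\<Sum>u\<in>UNIV. ?d u * (g u - c)\<^sup>2) =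
          (\<Sum>u\<in>UNIV. ?d u * (g u)\<^sup>2) - 2 * c * (\<Sum>u\<in>UNIV. ?d u * g u) + (\<Sum>u\<in>UNIV. ?d u * c\<^sup>2)"
        by (simp add: sum_distrib_left power2_diff algebra_simps sum.distrib sum_subtractf)
      moreover have "(\<Sum>u\<in>UNIV. ?d u * c\<^sup>2) \<ge> 0" by (intro sum_nonneg) auto
      ultimately have "y \<bullet> y \<le> (\<Sum>u\<in>UNIV. ?d u * (g u - c)\<^sup>2)" by (simp add: orth yy)
      then show ?thesis using E mult_left_mono[OF _ nonneg] by (meson order_trans)
    qed
    moreover have "\<exists>u. g u \<noteq> c" for c
    proof (rule ccontr)
      assume "\<not> (\<exists>u. g u \<noteq> c)"
      then have g: "g u = c" for u by blast
      have "(\<Sum>u\<in>UNIV. ?d u) * c = 0" using orth by (simp add: g sum_distrib_right)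
      moreover have "(\<Sum>u\<in>UNIV. ?d u) > 0" using pos by (intro sum_pos) auto
      ultimately have "c = 0" by simp
      then have "y = 0" using yu g by (simp add: vec_eq_iff)
      then show False using y(1) by blast
    qed
    ultimately show ?thesis using that by blast
  qed
qed

lemma nl_eigenvalue_2_normalized_test_function:
  fixes G :: "'v::finite \<Rightarrow> 'v \<Rightarrow> bool"
  assumes "simple_graph G" "CARD('v) \<ge> 2"
  obtains f p q where "f p = 1" "f q = -1" "\<And>u. \<bar>f u\<bar> \<le> 1"
    "dirichlet_energy G f \<le> nl_eigenvalue G 2 * (\<Sum>u\<in>UNIV. real (vertex_degree G u) * (f u)\<^sup>2)"
proof -
  obtain g where g: "\<And>c. \<exists>u. g u \<noteq> c"
    "\<And>c. dirichlet_energy G g \<le>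
      nl_eigenvalue G 2 * (\<Sum>u\<in>UNIV. real (vertex_degree G u) * (g u - c)\<^sup>2)"
    using nl_eigenvalue_2_test_function[OF assms] by blast
  have "Max (range g) \<in> range g" "Min (range g) \<in> range g" by (auto intro: Max_in Min_in)
  then obtain p q where "g p = Max (range g)" "g q = Min (range g)" by (metis imageE)
  then have p: "g u \<le> g p" and q: "g q \<le> g u" for u by simp_all
  have less: "g q < g p"
    using p q g(1)[of "g p"] by (metis order_antisym_conv not_le_imp_less order_trans)
  \<comment> \<open>The midpoint and scale that send the range of \<open>g\<close> onto an interval
    from -1 to 1.\<close>
  define c a where "c = (g p + g q) / 2" and "a = 2 / (g p - g q)"
  define f where "f u = a * (g u - c)" for u
  have "a > 0" using less by (simp add: a_def)
  have fp: "f p = 1" and fq: "f q = -1"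
    using less by (simp_all add: f_def a_def c_def field_simps)
  have "f u \<le> f p" "f q \<le> f u" for u
    using p[of u] q[of u] \<open>a > 0\<close> by (simp_all add: f_def)
  then have "\<bar>f u\<bar> \<le> 1" for u using fp fq by (metis abs_le_iff minus_le_iff)
  moreover have "dirichlet_energy G f \<le>
      a\<^sup>2 * (nl_eigenvalue G 2 * (\<Sum>u\<in>UNIV. real (vertex_degree G u) * (g u - c)\<^sup>2))"
    unfolding f_def[abs_def] dirichlet_energy_affine by (intro mult_left_mono g) auto
  then have "dirichlet_energy G f \<le> nl_eigenvalue G 2 * (\<Sum>u\<in>UNIV. real (vertex_degree G u) * (f u)\<^sup>2)"
    by (simp add: f_def power_mult_distrib sum_distrib_left mult_ac)
  ultimately show ?thesis using that fp fq by blast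
qed

section \<open>Functions of small energy\<close>

lemma vertex_degree_le:
  fixes G :: "'v::finite \<Rightarrow> 'v \<Rightarrow> bool"
  assumes "\<And>x. x \<in> X \<Longrightarrow> \<not> G u x"
  shows "real (vertex_degree G u) \<le> real CARD('v) - real (card X)"
proof -
  have "vertex_degree G u \<le> card (- X)"
    unfolding vertex_degree_def using assms by (intro card_mono) auto
  also have "\<dots> = CARD('v) - card X" by (simp add: Compl_eq_Diff_UNIV card_Diff_subset)
  finally show ?thesis using card_mono[of UNIV X] by (simp add: of_nat_diff)
qed

text \<open>Here \<open>m\<close> stands for the order of the graph or one less. \<open>m_eq\<close>
  covers orders 2 and 4, where \<open>m = real CARD('v) - 1\<close> would turn the estimates of
  \<open>energy_less_4\<close> and \<open>no_path_with_shared_neighbours\<close> respectively into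
  equalities.\<close>

locale slow_function =
  fixes G :: "'v::finite \<Rightarrow> 'v \<Rightarrow> bool" and f :: "'v \<Rightarrow> real" and p q :: 'v and m :: real
  assumes simple: "simple_graph G"
    and max_at: "f p = 1" and min_at: "f q = -1" and bounded: "\<And>u. \<bar>f u\<bar> \<le> 1"
    and energy: "m\<^sup>2 * dirichlet_energy G f \<le> 2 * (\<Sum>u\<in>UNIV. real (vertex_degree G u) * (f u)\<^sup>2)"
    and m_ge: "m \<ge> real CARD('v) - 1"
    and m_eq: "CARD('v) \<in> {2, 4} \<Longrightarrow> m = real CARD('v)"
begin

abbreviation "d u \<equiv> real (vertex_degree G u)"

lemma sym: "G u v \<Longrightarrow> G v u"
  using simple by (auto simp: simple_graph_def dest: sympD)

lemma irrefl: "\<not> G u u"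
  using simple by (auto simp: simple_graph_def irreflp_def)

lemma p_neq_q: "p \<noteq> q"
  using max_at min_at by auto

lemma card_ge_2: "CARD('v) \<ge> 2"
  using card_mono[of "UNIV :: 'v set" "{p, q}"] p_neq_q by simp

lemma energy_ge_edges:
  assumes "F \<subseteq> {(u, v). G u v}" "\<And>u v. (u, v) \<in> F \<Longrightarrow> (v, u) \<notin> F"
  shows "(\<Sum>(u, v)\<in>F. (f u - f v)\<^sup>2) \<le> dirichlet_energy G f"
  using simple assms by (intro dirichlet_energy_ge_sum_edges) (auto simp: simple_graph_def)

lemma f_sq_le: "(f u)\<^sup>2 \<le> 1"
  using bounded[of u] by (simp add: abs_square_le_1)

lemma weighted_norm_le:
  "(\<Sum>u\<in>A. d u * (f u)\<^sup>2) \<le> (\<Sum>u\<in>A. d u)"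
  by (intro sum_mono) (simp add: mult_left_le f_sq_le)

lemma degree_le: "d u \<le> real CARD('v) - 1"
  using vertex_degree_le[of "{u}" G u] irrefl by simp

text \<open>Lets every later result be used with \<open>p\<close> and \<open>q\<close>
  exchanged.\<close>

lemma mirror: "slow_function G (\<lambda>u. - f u) q p m"
proof
  show "m\<^sup>2 * dirichlet_energy G (\<lambda>u. - f u) \<le> 2 * (\<Sum>u\<in>UNIV. d u * (- f u)\<^sup>2)"
    using energy dirichlet_energy_affine[of G "-1" f 0] by simp
qed (use simple max_at min_at bounded m_ge m_eq in auto)

text \<open>The volume is at most n(n-1), so energy 4 would give 2m^2 \<le> n(n-1), too small for m
  \<ge> n-1 once n \<ge> 3.\<close>

lemma energy_less_4: "dirichlet_energy G f < 4"
proof (rule ccontr)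
  let ?n = "real CARD('v)"
  assume "\<not> ?thesis"
  then have "m\<^sup>2 * 4 \<le> m\<^sup>2 * dirichlet_energy G f" by (intro mult_left_mono) auto
  also have "\<dots> \<le> 2 * (\<Sum>u\<in>(UNIV :: 'v set). ?n - 1)"
    using energy weighted_norm_le[of UNIV] sum_mono[of UNIV d "\<lambda>_. ?n - 1"] degree_le by fastforce
  finally have le: "2 * m\<^sup>2 \<le> ?n * (?n - 1)" by simp
  show False
  proof (cases "CARD('v) = 2")
    case True
    then show False using le m_eq by simp
  next
    case False
    then have card_ge: "?n \<ge> 3" using card_ge_2 by linarith
    then have "(?n - 1)\<^sup>2 \<le> m\<^sup>2" using m_ge by (intro power_mono) auto
    moreover have "(?n - 1) * (?n - 2) > 0" using card_ge by (intro mult_pos_pos) auto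
    ultimately show False using le by (simp add: algebra_simps power2_eq_square)
  qed
qed

lemma not_adjacent: "\<not> G p q"
proof
  assume "G p q"
  then show False
    using energy_ge_edges[of "{(p, q)}"] energy_less_4 p_neq_q by (simp add: max_at min_at)
qed

text \<open>A single common neighbour \<open>w\<close> forces energy \<open>2 + 2 * (f w)\<^sup>2\<close>, and every vertex other than
  \<open>w\<close> then misses \<open>p\<close> or \<open>q\<close>.\<close>

lemma no_common_neighbour:
  assumes w: "G p w" "G w q"
  shows False
proof -
  let ?n = "real CARD('v)"
  have ne: "w \<noteq> p" "w \<noteq> q" using w irrefl by auto
  \<comment> \<open>Two edge-disjoint paths of length 2 from \<open>p\<close> to \<open>q\<close>
    already cost energy 4.\<close>
  have unique: "w' = w" if "G p w'" "G w' q" for w'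
  proof (rule ccontr)
    assume "w' \<noteq> w"
    moreover have "w' \<noteq> p" "w' \<noteq> q" using that irrefl by auto
    ultimately have "(\<Sum>(u, v)\<in>{(p, w), (w, q), (p, w'), (w', q)}. (f u - f v)\<^sup>2) \<le> dirichlet_energy G f"
      using ne p_neq_q w that by (intro energy_ge_edges) auto
    then have "(1 - f w)\<^sup>2 + ((f w + 1)\<^sup>2 + ((1 - f w')\<^sup>2 + (f w' + 1)\<^sup>2)) \<le> dirichlet_energy G f"
      using ne p_neq_q \<open>w' \<noteq> w\<close> \<open>w' \<noteq> p\<close> \<open>w' \<noteq> q\<close> by (simp add: max_at min_at)
    moreover have "(1 - a)\<^sup>2 + (a + 1)\<^sup>2 = 2 + 2 * a\<^sup>2" for a :: real
      by (simp add: power2_eq_square algebra_simps)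
    from this[of "f w"] this[of "f w'"]
    have "(1 - f w)\<^sup>2 + ((f w + 1)\<^sup>2 + ((1 - f w')\<^sup>2 + (f w' + 1)\<^sup>2)) \<ge> 4"
      using zero_le_power2[of "f w"] zero_le_power2[of "f w'"] by linarith
    ultimately show False using energy_less_4 by linarith
  qed
  have card_ge: "?n \<ge> 3"
    using card_mono[of "UNIV :: 'v set" "{p, q, w}"] p_neq_q ne by simp
  have deg: "d u \<le> ?n - 2" if u: "u \<noteq> w" for u
  proof -
    obtain x where "x \<noteq> u" "\<not> G u x"
      using unique[of u] u not_adjacent sym p_neq_q by metis
    then show ?thesis using vertex_degree_le[of "{u, x}" G u] irrefl by auto
  qed
  have "(\<Sum>(u, v)\<in>{(p, w), (w, q)}. (f u - f v)\<^sup>2) \<le> dirichlet_energy G f"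
    using ne p_neq_q w by (intro energy_ge_edges) auto
  then have "2 + 2 * (f w)\<^sup>2 \<le> dirichlet_energy G f"
    using ne p_neq_q by (simp add: max_at min_at power2_eq_square algebra_simps)
  then have "m\<^sup>2 * (2 + 2 * (f w)\<^sup>2) \<le> m\<^sup>2 * dirichlet_energy G f" by (intro mult_left_mono) auto
  also have "\<dots> \<le> 2 * (\<Sum>u\<in>UNIV. d u * (f u)\<^sup>2)" by (rule energy)
  also have "(\<Sum>u\<in>UNIV. d u * (f u)\<^sup>2) = d w * (f w)\<^sup>2 + (\<Sum>u\<in>UNIV - {w}. d u * (f u)\<^sup>2)"
    by (simp add: sum.remove)
  also have "(\<Sum>u\<in>UNIV - {w}. d u * (f u)\<^sup>2) \<le> (\<Sum>u\<in>UNIV - {w}. ?n - 2)"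
    using weighted_norm_le[of "UNIV - {w}"] sum_mono[of "UNIV - {w}" d "\<lambda>_. ?n - 2"] deg by fastforce
  also have "(\<Sum>u\<in>UNIV - {w}. ?n - 2) = (?n - 1) * (?n - 2)"
    using card_ge_2 by (simp add: of_nat_diff)
  finally have le: "m\<^sup>2 + m\<^sup>2 * (f w)\<^sup>2 \<le> d w * (f w)\<^sup>2 + (?n - 1) * (?n - 2)"
    by (simp add: algebra_simps)
  have m: "(?n - 1)\<^sup>2 \<le> m\<^sup>2" using m_ge card_ge by (intro power_mono) auto
  have "(?n - 1) * 1 \<le> (?n - 1) * (?n - 1)" using card_ge by (intro mult_left_mono) auto
  \<comment> \<open>\<open>w\<close> may have full degree, but its contribution is absorbed by the
    extra energy from \<open>(f w)\<^sup>2\<close>.\<close>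
  then have "d w \<le> m\<^sup>2" using m degree_le[of w] by (simp add: power2_eq_square)
  then have "d w * (f w)\<^sup>2 \<le> m\<^sup>2 * (f w)\<^sup>2" by (intro mult_right_mono) auto
  then have "m\<^sup>2 \<le> (?n - 1) * (?n - 2)" using le by linarith
  then show False using m card_ge by (simp add: power2_eq_square algebra_simps)
qed

text \<open>Two parallel paths of length 2 from \<open>p\<close> to \<open>t\<close> followed by the
  edge \<open>t q\<close> have resistance 2, so a potential drop of 2 costs energy at least 2. Every
  vertex misses \<open>p\<close> or \<open>q\<close> besides itself, so all degrees are at most n-2,
  and m^2 \<le> n(n-2) < (n-1)^2.\<close>

lemma no_diamond_with_tail:
  assumes "G p s" "G s t" "G t q" "G p w" "G w t" "w \<noteq> s"
  shows False
proof -
  let ?n = "real CARD('v)"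
  have ne: "p \<noteq> s" "s \<noteq> t" "t \<noteq> q" "p \<noteq> w" "w \<noteq> t" "p \<noteq> q" "p \<noteq> t" "s \<noteq> q" "w \<noteq> q"
    using assms irrefl p_neq_q not_adjacent by auto
  have deg: "d u \<le> ?n - 2" for u
  proof -
    obtain x where "x \<noteq> u" "\<not> G u x"
      using no_common_neighbour[of u] not_adjacent sym p_neq_q by metis
    then show ?thesis using vertex_degree_le[of "{u, x}" G u] irrefl by auto
  qed
  have "(\<Sum>(u, v)\<in>{(p, s), (s, t), (p, w), (w, t), (t, q)}. (f u - f v)\<^sup>2) \<le> dirichlet_energy G f"
    using ne assms by (intro energy_ge_edges) auto
  then have "(1 - f s)\<^sup>2 + ((f s - f t)\<^sup>2 + ((1 - f w)\<^sup>2 + ((f w - f t)\<^sup>2 + (f t + 1)\<^sup>2))) \<le> dirichlet_energy G f"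
    using ne assms(6) by (simp add: max_at min_at)
  \<comment> \<open>Completing squares around the optimal value at \<open>s\<close> and
    \<open>w\<close>, the mean of the values at \<open>p\<close> and \<open>t\<close>.\<close>
  moreover have "(1 - f s)\<^sup>2 + ((f s - f t)\<^sup>2 + ((1 - f w)\<^sup>2 + ((f w - f t)\<^sup>2 + (f t + 1)\<^sup>2))) =
      2 + 2 * (f t)\<^sup>2 + 2 * (f s - (1 + f t) / 2)\<^sup>2 + 2 * (f w - (1 + f t) / 2)\<^sup>2"
    by (simp add: power2_eq_square field_simps)
  ultimately have "2 \<le> dirichlet_energy G f"
    by (smt (verit) zero_le_power2)
  then have "m\<^sup>2 * 2 \<le> m\<^sup>2 * dirichlet_energy G f" by (intro mult_left_mono) auto
  also have "\<dots> \<le> 2 * (\<Sum>u\<in>(UNIV :: 'v set). ?n - 2)"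
    using energy weighted_norm_le[of UNIV] sum_mono[of UNIV d "\<lambda>_. ?n - 2"] deg by fastforce
  finally have le: "m\<^sup>2 \<le> ?n * (?n - 2)" by simp
  have "(?n - 1)\<^sup>2 \<le> m\<^sup>2" using m_ge card_ge_2 by (intro power_mono) auto
  then show False using le by (simp add: power2_eq_square algebra_simps)
qed

text \<open>The path \<open>p s t q\<close> with all remaining vertices joined to \<open>s\<close> and \<open>t\<close> has effective resistance
  \<open>2 + 2 / (n - 2)\<close> between \<open>p\<close> and \<open>q\<close>, where \<open>n = CARD('v)\<close>.\<close>

lemma no_path_with_shared_neighbours:
  assumes path: "G p s" "G s t" "G t q" and st: "\<not> G p t" "\<not> G s q"
    and rest: "\<And>w. w \<notin> {p, q, s, t} \<Longrightarrow> G s w \<and> G w t \<and> \<not> G p w \<and> \<not> G w q"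
  shows False
proof -
  let ?n = "real CARD('v)"
  have ne: "p \<noteq> s" "s \<noteq> t" "t \<noteq> q" "p \<noteq> q" "p \<noteq> t" "s \<noteq> q"
    using path irrefl p_neq_q not_adjacent by auto
  define W where "W = - {p, q, s, t}"
  have cW: "real (card W) = ?n - 4"
  proof -
    have "card {p, q, s, t} = 4" using ne by simp
    moreover have "card {p, q, s, t} \<le> CARD('v)" by (intro card_mono) auto
    ultimately show ?thesis by (simp add: W_def Compl_eq_Diff_UNIV card_Diff_subset of_nat_diff)
  qed
  then have card_ge: "?n \<ge> 4" by (metis diff_ge_0_iff_ge of_nat_0_le_iff)
  have split: "(\<Sum>u\<in>UNIV. h u) = h p + h q + h s + h t + (\<Sum>u\<in>W. h u)" for h :: "'v \<Rightarrow> real"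
  proof -
    have "sum h UNIV = sum h W + sum h {p, q, s, t}"
      using sum.subset_diff[of "{p, q, s, t}" UNIV h] by (simp add: W_def Compl_eq_Diff_UNIV)
    then show ?thesis using ne by simp
  qed
  have "G p v \<longleftrightarrow> v = s" "G v q \<longleftrightarrow> v = t" for v
    using path st rest[of v] not_adjacent irrefl[of p] irrefl[of q] ne
    by (cases "v \<in> {p, q, s, t}"; auto)+
  moreover have flip: "G u v \<longleftrightarrow> G v u" for u v using sym by blast
  ultimately have "{v. G p v} = {s}" "{v. G q v} = {t}" by (auto simp: flip[of q])
  then have dpq: "d p = 1" "d q = 1" by (simp_all add: vertex_degree_def)
  have dst: "d s \<le> ?n - 2" "d t \<le> ?n - 2"
    using vertex_degree_le[of "{s, q}" G s] vertex_degree_le[of "{t, p}" G t] st irrefl ne flip[of t p] by auto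
  have dW: "d u \<le> ?n - 3" if "u \<in> W" for u
  proof -
    have "\<not> G u x" if "x \<in> {u, p, q}" for x
      using that \<open>u \<in> W\<close> rest[of u] irrefl flip[of u p] by (auto simp: W_def)
    then show ?thesis
      using vertex_degree_le[of "{u, p, q}" G u] that ne by (auto simp: W_def)
  qed
  have "(\<Sum>u\<in>W. d u) \<le> (\<Sum>u\<in>W. ?n - 3)" using dW by (rule sum_mono)
  then have vol: "(\<Sum>u\<in>UNIV. d u) \<le> 2 + 2 * (?n - 2) + (?n - 4) * (?n - 3)"
    using dpq dst by (simp add: split cW)
  \<comment> \<open>Each path \<open>s w t\<close> conducts at least like a single edge of weight
    1/2.\<close>
  have star: "(f s - f w)\<^sup>2 + (f w - f t)\<^sup>2 \<ge> (f s - f t)\<^sup>2 / 2" for w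
  proof -
    have "(f s - f w)\<^sup>2 + (f w - f t)\<^sup>2 = (f s - f t)\<^sup>2 / 2 + 2 * (f w - (f s + f t) / 2)\<^sup>2"
      by (simp add: power2_eq_square field_simps)
    then show ?thesis by simp
  qed
  have "(\<Sum>(u, v)\<in>{(p, s), (s, t), (t, q)} \<union> (Pair s ` W \<union> (\<lambda>w. (w, t)) ` W). (f u - f v)\<^sup>2)
      \<le> dirichlet_energy G f"
    using ne path rest by (intro energy_ge_edges) (auto simp: W_def)
  also have "(\<Sum>(u, v)\<in>{(p, s), (s, t), (t, q)} \<union> (Pair s ` W \<union> (\<lambda>w. (w, t)) ` W). (f u - f v)\<^sup>2) =
      (\<Sum>(u, v)\<in>{(p, s), (s, t), (t, q)}. (f u - f v)\<^sup>2) +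
      ((\<Sum>(u, v)\<in>Pair s ` W. (f u - f v)\<^sup>2) + (\<Sum>(u, v)\<in>(\<lambda>w. (w, t)) ` W. (f u - f v)\<^sup>2))"
  proof -
    have "(Pair s ` W) \<inter> ((\<lambda>w. (w, t)) ` W) = {}"
      "{(p, s), (s, t), (t, q)} \<inter> (Pair s ` W \<union> (\<lambda>w. (w, t)) ` W) = {}"
      by (auto simp: W_def)
    then show ?thesis by (simp only: sum.union_disjoint finite finite_Un finite_imageI)
  qed
  also have "\<dots> = (1 - f s)\<^sup>2 + (f s - f t)\<^sup>2 + (f t + 1)\<^sup>2 + (\<Sum>w\<in>W. (f s - f w)\<^sup>2 + (f w - f t)\<^sup>2)"
    using ne by (simp add: sum.reindex inj_on_def sum.distrib max_at min_at)
  finally have "(1 - f s)\<^sup>2 + (f s - f t)\<^sup>2 + (f t + 1)\<^sup>2 + (\<Sum>w\<in>W. (f s - f w)\<^sup>2 + (f w - f t)\<^sup>2)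
      \<le> dirichlet_energy G f" .
  moreover have "(\<Sum>w\<in>W. (f s - f w)\<^sup>2 + (f w - f t)\<^sup>2) \<ge> (\<Sum>w\<in>W. (f s - f t)\<^sup>2 / 2)"
    by (intro sum_mono star)
  ultimately have E: "(1 - f s)\<^sup>2 + (f t + 1)\<^sup>2 + (?n - 2) / 2 * (f s - f t)\<^sup>2 \<le> dirichlet_energy G f"
    by (simp add: cW field_simps)
  define b where "b = f s - f t"
  have "(1 - f s)\<^sup>2 + (f t + 1)\<^sup>2 = (2 - b)\<^sup>2 / 2 + (f s + f t)\<^sup>2 / 2"
    by (simp add: b_def power2_eq_square field_simps)
  then have "(2 - b)\<^sup>2 + (?n - 2) * b\<^sup>2 \<le> 2 * dirichlet_energy G f"
    using E by (simp add: b_def[symmetric] field_simps) (smt (verit) zero_le_power2)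
  \<comment> \<open>Completing the square in the drop \<open>b\<close> from \<open>s\<close> to
    \<open>t\<close>; the optimum is b = 2/(n-1).\<close>
  moreover have "(?n - 1) * ((2 - b)\<^sup>2 + (?n - 2) * b\<^sup>2) = 4 * (?n - 2) + ((?n - 1) * b - 2)\<^sup>2"
    by (simp add: power2_eq_square algebra_simps)
  ultimately have "4 * (?n - 2) \<le> (?n - 1) * (2 * dirichlet_energy G f)"
    using card_ge mult_left_mono[of "(2 - b)\<^sup>2 + (?n - 2) * b\<^sup>2" "2 * dirichlet_energy G f" "?n - 1"]
      zero_le_power2[of "(?n - 1) * b - 2"] by linarith
  then have "m\<^sup>2 * (2 * (?n - 2)) \<le> m\<^sup>2 * ((?n - 1) * dirichlet_energy G f)"
    by (intro mult_left_mono) auto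
  also have "\<dots> = (?n - 1) * (m\<^sup>2 * dirichlet_energy G f)" by simp
  also have "\<dots> \<le> (?n - 1) * (2 * (2 + 2 * (?n - 2) + (?n - 4) * (?n - 3)))"
    using energy weighted_norm_le[of UNIV] vol card_ge by (intro mult_left_mono) auto
  finally have le: "m\<^sup>2 * (?n - 2) \<le> (?n - 1) * (2 + 2 * (?n - 2) + (?n - 4) * (?n - 3))"
    by (simp add: algebra_simps)
  show False
  proof (cases "CARD('v) = 4")
    case True
    then show False using le m_eq by simp
  next
    case False
    then have card_ge_5: "?n \<ge> 5" using card_ge by linarith
    have "(?n - 1)\<^sup>2 \<le> m\<^sup>2" using m_ge card_ge by (intro power_mono) auto
    then have "(?n - 1)\<^sup>2 * (?n - 2) \<le> m\<^sup>2 * (?n - 2)" using card_ge by (intro mult_right_mono) auto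
    then have "(?n - 1) * ((?n - 1) * (?n - 2)) \<le> (?n - 1) * (2 + 2 * (?n - 2) + (?n - 4) * (?n - 3))"
      using le by (simp add: power2_eq_square mult.assoc)
    then have "(?n - 1) * (?n - 2) \<le> 2 + 2 * (?n - 2) + (?n - 4) * (?n - 3)"
      using card_ge by (simp add: mult_le_cancel_left)
    \<comment> \<open>The inequality simplifies to n \<le> 4.\<close>
    then show False using card_ge_5 by (simp add: algebra_simps)
  qed
qed

end

section \<open>Slow functions on a graph and on its complement\<close>

lemma simple_graph_complement:
  "simple_graph G \<Longrightarrow> simple_graph (graph_complement G)"
  by (auto simp: simple_graph_def graph_complement_def symp_def irreflp_def)

text \<open>The edge \<open>p s\<close> makes \<open>p s t q\<close> an induced path in
  \<open>G\<close>, and \<open>s q p t\<close> is then an induced path in the complement. Applying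
  \<open>no_diamond_with_tail\<close> to both paths and their reversals fixes how each further
  vertex is attached.\<close>

lemma no_slow_functions_aligned:
  assumes "slow_function G f p q m" and "slow_function (graph_complement G) g s t m" and "G p s"
  shows False
proof -
  interpret A: slow_function G f p q m by fact
  interpret B: slow_function "graph_complement G" g s t m by fact
  interpret A': slow_function G "\<lambda>u. - f u" q p m by (rule A.mirror)
  interpret B': slow_function "graph_complement G" "\<lambda>u. - g u" t s m by (rule B.mirror)
  let ?B = "graph_complement G"
  have B: "?B u v \<longleftrightarrow> u \<noteq> v \<and> \<not> G u v" for u v by (simp add: graph_complement_def)
  have sym: "G u v \<longleftrightarrow> G v u" for u v using A.sym by blast
  have pq: "\<not> G p q" "p \<noteq> q" by (fact A.not_adjacent A.p_neq_q)+
  have st: "G s t" "s \<noteq> t" using B.not_adjacent B.p_neq_q by (auto simp: B)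
  have A2: "\<not> (G p w \<and> G q w)" for w using A.no_common_neighbour[of w] sym by blast
  have B2: "\<not> (?B s w \<and> ?B t w)" for w using B.no_common_neighbour[of w] sym by (auto simp: B)
  have ne: "p \<noteq> s" "q \<noteq> s" using \<open>G p s\<close> A.irrefl pq by auto
  have "\<not> G q s" using A2 \<open>G p s\<close> by blast
  then have "?B s q" using ne sym by (auto simp: B)
  then have qt: "G q t"
    using B2[of q] A2[of t] pq st \<open>\<not> G q s\<close> sym by (auto simp: B)
  then have "\<not> G p t" using A2 by blast
  have ne': "p \<noteq> t" "q \<noteq> t" using qt pq A.irrefl sym by auto
  have w: "G s w \<and> G w t \<and> \<not> G p w \<and> \<not> G w q" if "w \<notin> {p, q, s, t}" for w
  proof -
    have "\<not> (G p w \<and> G w t)"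
      using A.no_diamond_with_tail[of s t w] that \<open>G p s\<close> st qt sym by blast
    moreover have "\<not> (G q w \<and> G w s)"
      using A'.no_diamond_with_tail[of t s w] that \<open>G p s\<close> st qt sym by blast
    moreover have "\<not> (?B s w \<and> ?B w p)"
      using B.no_diamond_with_tail[of q p w] that pq ne ne' \<open>\<not> G q s\<close> \<open>\<not> G p t\<close> sym by (auto simp: B)
    moreover have "\<not> (?B t w \<and> ?B w q)"
      using B'.no_diamond_with_tail[of p q w] that pq ne ne' \<open>\<not> G q s\<close> \<open>\<not> G p t\<close> sym by (auto simp: B)
    ultimately show ?thesis
      using A2[of w] B2[of w] that sym by (auto simp: B)
  qed
  then show False
    using A.no_path_with_shared_neighbours[of s t] \<open>G p s\<close> st qt \<open>\<not> G p t\<close> \<open>\<not> G q s\<close> sym by blast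
qed

text \<open>Mirroring reduces any edge of \<open>G\<close> between \<open>{p, q}\<close> and
  \<open>{s, t}\<close> to the aligned case. Without such an edge, a vertex of \<open>{p, q}\<close>
  outside \<open>{s, t}\<close> would be a common neighbour of \<open>s\<close> and \<open>t\<close>
  in the complement, so the pairs coincide; but \<open>G\<close> lacks the edge \<open>p q\<close>
  and the complement lacks \<open>s t\<close>.\<close>

lemma no_slow_functions:
  assumes "slow_function G f p q m" and "slow_function (graph_complement G) g s t m"
  shows False
proof -
  interpret A: slow_function G f p q m by fact
  interpret B: slow_function "graph_complement G" g s t m by fact
  have "\<not> G p s" by (rule notI) (rule no_slow_functions_aligned[OF assms])
  moreover have "\<not> G p t" by (rule notI) (rule no_slow_functions_aligned[OF assms(1) B.mirror])
  moreover have "\<not> G q s" by (rule notI) (rule no_slow_functions_aligned[OF A.mirror assms(2)])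
  moreover have "\<not> G q t" by (rule notI) (rule no_slow_functions_aligned[OF A.mirror B.mirror])
  ultimately show False
    using A.p_neq_q B.p_neq_q A.not_adjacent B.not_adjacent B.no_common_neighbour[of p]
      B.no_common_neighbour[of q] A.sym by (auto simp: graph_complement_def)
qed

lemma slow_function_exists:
  fixes G :: "'v::finite \<Rightarrow> 'v \<Rightarrow> bool"
  assumes "simple_graph G" "CARD('v) \<ge> 2" and "nl_eigenvalue G 2 \<le> 2 / m\<^sup>2" "m > 0"
    and "m \<ge> real CARD('v) - 1" "CARD('v) \<in> {2, 4} \<Longrightarrow> m = real CARD('v)"
  obtains f p q where "slow_function G f p q m"
proof -
  obtain f p q where f: "f p = 1" "f q = -1" "\<And>u. \<bar>f u\<bar> \<le> 1"
    "dirichlet_energy G f \<le> nl_eigenvalue G 2 * (\<Sum>u\<in>UNIV. real (vertex_degree G u) * (f u)\<^sup>2)"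
    by (rule nl_eigenvalue_2_normalized_test_function[OF assms(1,2)]) blast
  have "dirichlet_energy G f \<le> 2 / m\<^sup>2 * (\<Sum>u\<in>UNIV. real (vertex_degree G u) * (f u)\<^sup>2)"
    using assms(3) by (intro order_trans[OF f(4)] mult_right_mono sum_nonneg) auto
  then have "m\<^sup>2 * dirichlet_energy G f \<le> 2 * (\<Sum>u\<in>UNIV. real (vertex_degree G u) * (f u)\<^sup>2)"
    using assms(4) by (simp add: field_simps)
  then have "slow_function G f p q m"
    using f assms by unfold_locales auto
  then show ?thesis by (rule that)
qed

theorem theorem3p2:
  fixes G :: "'v::finite \<Rightarrow> 'v \<Rightarrow> bool" and n :: nat
  assumes "simple_graph G" and "n = CARD('v)" and "n \<ge> 2"
  shows "(even n \<longrightarrow>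
            max (nl_eigenvalue G 2) (nl_eigenvalue (graph_complement G) 2) > 2 / (real n)\<^sup>2) \<and>
         (odd n \<longrightarrow>
            max (nl_eigenvalue G 2) (nl_eigenvalue (graph_complement G) 2) > 2 / (real n - 1)\<^sup>2)"
proof -
  \<comment> \<open>Both parities become one bound; orders 2 and 4 are even, so \<open>m\<close>
    equals the order there.\<close>
  define m where "m = (if even n then real n else real n - 1)"
  have "max (nl_eigenvalue G 2) (nl_eigenvalue (graph_complement G) 2) > 2 / m\<^sup>2"
  proof (rule ccontr)
    assume "\<not> ?thesis"
    then have le: "nl_eigenvalue G 2 \<le> 2 / m\<^sup>2" "nl_eigenvalue (graph_complement G) 2 \<le> 2 / m\<^sup>2"
      by auto
    have n: "CARD('v) \<ge> 2" and m: "m > 0" "m \<ge> real CARD('v) - 1"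
      "CARD('v) \<in> {2, 4} \<Longrightarrow> m = real CARD('v)"
      using assms(2,3) by (auto simp: m_def)
    obtain f p q where "slow_function G f p q m"
      by (rule slow_function_exists[OF assms(1) n le(1) m])
    moreover obtain g s t where "slow_function (graph_complement G) g s t m"
      by (rule slow_function_exists[OF simple_graph_complement[OF assms(1)] n le(2) m])
    ultimately show False by (rule no_slow_functions)
  qed
  then show ?thesis by (auto simp: m_def)
qed

end
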